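(* Let $n\ge4$ be an integer, $0\le\alpha\le1$, and put $\beta=1-\alpha$ and $\gamma=(1-\alpha)(n-3)$. The generalised distance spectrum of the torch graph $O_n$ (the multiset of eigenvalues of $D_\alpha(O_n)$, superscripts denoting multiplicities) is $$\operatorname{Spec}_{D_\alpha}(O_n)=\left\{((2n+11)\alpha-2)^{\,n-4},\ (3n+3)\alpha-2,\ (n+9)\alpha-1,\ \lambda_1,\ldots,\lambda_6\right\},$$ where $\lambda_1,\ldots,\lambda_6$ are the eigenvalues (with algebraic multiplicity) of the matrix $$M=\begin{pmatrix}(2n+1)\alpha&2\gamma&2\beta&\beta&2\beta&2\beta\\2\beta&17\alpha+2n-8&4\beta&3\beta&2\beta&6\beta\\2\beta&4\gamma&(4n+1)\alpha&\beta&6\beta&4\beta\\\beta&3\gamma&\beta&(3n-1)\alpha&4\beta&2\beta\\\beta&\gamma&3\beta&2\beta&(n+7)\alpha+1&4\beta\\\beta&3\gamma&2\beta&\beta&4\beta&(3n-1)\alpha+2\end{pmatrix}.$$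
   Context: For a connected graph $\Gamma$ with vertices $u_1,\dots,u_N$, the distance matrix is $D(\Gamma)=(d(u_i,u_j))_{i,j}$, where $d$ is the shortest-path distance; the transmission of $u_i$ is $Tr_i=\sum_{w\in V(\Gamma)}d(w,u_i)$ and $Tr(\Gamma)=\operatorname{diag}(Tr_1,\dots,Tr_N)$. The generalised distance matrix is $D_\alpha(\Gamma)=\alpha\,Tr(\Gamma)+(1-\alpha)D(\Gamma)$, $0\le\alpha\le1$. For $n\ge 4$, the torch graph $O_n$ is the simple graph on the $n+4$ vertices $v_1,\dots,v_{n+4}$ with exactly the following edges: $v_{n+1}v_{n+3}$; $v_{n+1}v_i$ and $v_{n+3}v_i$ for every $2\le i\le n-2$; $v_1v_{n+1}$ and $v_1v_{n+3}$; $v_1v_{n+2}$ and $v_1v_{n+4}$; $v_nv_1$, $v_nv_{n+2}$ and $v_nv_{n+4}$; and $v_nv_{n-1}$. *)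

theory Defs
  imports "Graph_Theory.Graph_Theory" "Jordan_Normal_Form.Char_Poly"
begin

text \<open>Simple graphs are symmetric loop-free digraphs without parallel arcs (locale
  \<open>pair_graph\<close>). The distance is the least cost of a walk when every arc has cost 1. The library
  value \<open>\<mu>\<close> is an extended real, equal to \<open>\<infinity>\<close> exactly if there is no walk; the
  truncation to \<open>real\<close> therefore loses nothing on a connected graph.\<close>

definition graph_dist :: "('a, 'b) pre_digraph \<Rightarrow> 'a \<Rightarrow> 'a \<Rightarrow> real" where
  "graph_dist G u v = real_of_ereal (wf_digraph.\<mu> G (\<lambda>_. 1) u v)"

definition transmission :: "('a, 'b) pre_digraph \<Rightarrow> 'a \<Rightarrow> real" where
  "transmission G u = (\<Sum>w \<in> verts G. graph_dist G w u)"

text \<open>Below, \<open>us\<close> is an enumeration of the vertices of \<open>G\<close> without repetition.\<close>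

definition distance_mat :: "('a, 'b) pre_digraph \<Rightarrow> 'a list \<Rightarrow> real mat" where
  "distance_mat G us = mat (length us) (length us) (\<lambda>(i, j). graph_dist G (us ! i) (us ! j))"

definition transmission_mat :: "('a, 'b) pre_digraph \<Rightarrow> 'a list \<Rightarrow> real mat" where
  "transmission_mat G us = mat_diag (length us) (\<lambda>i. transmission G (us ! i))"

definition gen_distance_mat :: "real \<Rightarrow> ('a, 'b) pre_digraph \<Rightarrow> 'a list \<Rightarrow> real mat" where
  "gen_distance_mat \<alpha> G us =
     \<alpha> \<cdot>\<^sub>m transmission_mat G us + (1 - \<alpha>) \<cdot>\<^sub>m distance_mat G us"

text \<open>All complex eigenvalues with algebraic multiplicity: a real matrix that is not symmetric
  need not have all its eigenvalues in the reals.\<close>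

definition eigenvalue_mset :: "real mat \<Rightarrow> complex multiset" where
  "eigenvalue_mset A = proots (char_poly (map_mat complex_of_real A))"

text \<open>The vertex \<open>v\<^sub>i\<close> is the number \<open>i\<close>. Each edge is listed in one
  orientation only; \<open>torch_graph\<close> adds the opposite arcs.\<close>

definition torch_edges :: "nat \<Rightarrow> (nat \<times> nat) set" where
  "torch_edges n =
     {(n + 1, n + 3)}
     \<union> {(n + 1, i) | i. 2 \<le> i \<and> i \<le> n - 2} \<union> {(n + 3, i) | i. 2 \<le> i \<and> i \<le> n - 2}
     \<union> {(1, n + 1), (1, n + 3)}
     \<union> {(1, n + 2), (1, n + 4)}
     \<union> {(n, 1), (n, n + 2), (n, n + 4)}
     \<union> {(n, n - 1)}"

definition torch_graph :: "nat \<Rightarrow> nat pair_pre_digraph" where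
  "torch_graph n = \<lparr>pverts = {1..n + 4}, parcs = torch_edges n \<union> (torch_edges n)\<inverse>\<rparr>"

lemma pair_graph_torch_graph:
  assumes "n \<ge> 4"
  shows "pair_graph (torch_graph n)"
proof
  show "symmetric (with_proj (torch_graph n))"
    by (auto simp: symmetric_def torch_graph_def sym_def)
  have "parcs (torch_graph n) \<subseteq> {1..n + 4} \<times> {1..n + 4}"
    using assms by (auto simp: torch_graph_def torch_edges_def)
  then show "finite (parcs (torch_graph n))"
    by (rule finite_subset) simp
qed (use assms in \<open>auto simp: torch_graph_def torch_edges_def\<close>)

lemma connected_torch_graph:
  assumes "n \<ge> 4"
  shows "connected (with_proj (torch_graph n))"
proof -
  interpret pair_graph "torch_graph n"
    by (rule pair_graph_torch_graph[OF assms])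
  let ?G = "with_proj (torch_graph n)"
  have adj: "u \<rightarrow>\<^sup>*\<^bsub>?G\<^esub> v" if "(u, v) \<in> parcs (torch_graph n)" for u v
    using that by (intro reachable_adjI) simp
  have to1: "u \<rightarrow>\<^sup>*\<^bsub>?G\<^esub> 1" if "u \<in> {1..n + 4}" for u
  proof -
    consider "u = 1" | "2 \<le> u \<and> u \<le> n - 2" | "u = n - 1" | "u = n" | "u = n + 1"
      | "u = n + 2" | "u = n + 3" | "u = n + 4"
      using \<open>u \<in> {1..n + 4}\<close> by fastforce
    then show ?thesis
    proof cases
      case 1
      then show ?thesis
        using reachable_refl[of u] by (simp add: torch_graph_def)
    next
      case 2
      then have "u \<rightarrow>\<^sup>*\<^bsub>?G\<^esub> (n + 1)" "(n + 1) \<rightarrow>\<^sup>*\<^bsub>?G\<^esub> 1"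
        by (intro adj; auto simp: torch_graph_def torch_edges_def)+
      then show ?thesis by (rule reachable_trans)
    next
      case 3
      then have "u \<rightarrow>\<^sup>*\<^bsub>?G\<^esub> n" "n \<rightarrow>\<^sup>*\<^bsub>?G\<^esub> 1"
        by (intro adj; auto simp: torch_graph_def torch_edges_def)+
      then show ?thesis by (rule reachable_trans)
    qed (intro adj; auto simp: torch_graph_def torch_edges_def)+
  qed
  have "u \<rightarrow>\<^sup>*\<^bsub>?G\<^esub> v" if "u \<in> {1..n + 4}" "v \<in> {1..n + 4}" for u v
    using to1[OF that(1)] symmetric_reachable[OF sym_arcs to1[OF that(2)]] by (rule reachable_trans)
  then have "strongly_connected ?G"
    by (intro strongly_connectedI) (simp_all add: torch_graph_def)
  moreover have "mk_symmetric ?G = torch_graph n"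
    by (auto simp: mk_symmetric_def torch_graph_def)
  ultimately show ?thesis
    by (simp add: connected_def)
qed

text \<open>The list \<open>[1..<n + 5]\<close> is \<open>v\<^sub>1, \<dots>, v\<^bsub>n+4\<^esub>\<close>.\<close>

definition torch_gen_distance_spec :: "real \<Rightarrow> nat \<Rightarrow> complex multiset" where
  "torch_gen_distance_spec \<alpha> n =
     eigenvalue_mset (gen_distance_mat \<alpha> (with_proj (torch_graph n)) [1..<n + 5])"

definition torch_mat :: "real \<Rightarrow> real \<Rightarrow> real \<Rightarrow> real \<Rightarrow> real mat" where
  "torch_mat n \<alpha> \<beta> \<gamma> = mat_of_rows_list 6
     [[(2*n + 1)*\<alpha>, 2*\<gamma>, 2*\<beta>, \<beta>, 2*\<beta>, 2*\<beta>],
      [2*\<beta>, 17*\<alpha> + 2*n - 8, 4*\<beta>, 3*\<beta>, 2*\<beta>, 6*\<beta>],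
      [2*\<beta>, 4*\<gamma>, (4*n + 1)*\<alpha>, \<beta>, 6*\<beta>, 4*\<beta>],
      [\<beta>, 3*\<gamma>, \<beta>, (3*n - 1)*\<alpha>, 4*\<beta>, 2*\<beta>],
      [\<beta>, \<gamma>, 3*\<beta>, 2*\<beta>, (n + 7)*\<alpha> + 1, 4*\<beta>],
      [\<beta>, 3*\<gamma>, 2*\<beta>, \<beta>, 4*\<beta>, (3*n - 1)*\<alpha> + 2]]"

end

theory Submission
  imports Defs
begin

text \<open>The vertices of the torch graph fall into six classes: \<open>{v\<^sub>1}\<close>,
  \<open>{v\<^sub>2, \<dots>, v\<^bsub>n-2\<^esub>}\<close>, \<open>{v\<^bsub>n-1\<^esub>}\<close>,
  \<open>{v\<^sub>n}\<close>, \<open>{v\<^bsub>n+1\<^esub>, v\<^bsub>n+3\<^esub>}\<close> and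
  \<open>{v\<^bsub>n+2\<^esub>, v\<^bsub>n+4\<^esub>}\<close>. Two vertices of the same class are twins, that is,
  they have the same neighbours apart from each other. Therefore the distance between two distinct
  vertices depends only on their classes, and so does the transmission of a vertex.

  Let the class \<open>a\<close> have \<open>m\<^sub>a\<close> elements. The generalised distance matrix then has
  the form \<open>A = X S X\<^sup>T + diag(t)\<close>, where \<open>X\<close> is the 0/1 incidence matrix of
  vertices and classes, \<open>S\<close> is indexed by classes, and \<open>t\<close> is constant on classes.
  For two twins \<open>u\<close>, \<open>v\<close> of class \<open>a\<close>, the vector
  \<open>e\<^sub>u - e\<^sub>v\<close> is killed by \<open>X\<^sup>T\<close>, so it is an eigenvector with
  eigenvalue \<open>t\<^sub>a\<close>; these vectors account for \<open>m\<^sub>a - 1\<close> eigenvalues per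
  class. On the complementary space of vectors that are constant on classes, \<open>A\<close> acts as the
  quotient matrix \<open>S diag(m) + diag(t)\<close>, which is the 6 by 6 matrix of the theorem.
  The class sizes are 1, \<open>n - 3\<close>, 1, 1, 2 and 2, so at most three classes
  contribute eigenvalues \<open>t\<^sub>a\<close>.

  To obtain algebraic multiplicities without constructing a basis, the factorisation is proved for the
  characteristic polynomials, from an identity of Sylvester type for determinants
  (\<open>det_intertwined_low_rank_update\<close>); its consequence for spectra is
  \<open>eigenvalue_mset_class_mat\<close>. The distances are certified by \<open>graph_dist_eqI\<close>: a
  function that vanishes at the target, decreases by at most 1 along an arc, and can be decreased at
  every other vertex is the distance to the target. For the torch graph both conditions become
  statements about the six classes, which are checked by evaluation.\<close>

section \<open>Spectra of matrices that are constant on classes\<close>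

text \<open>For \<open>T\<close> and \<open>T'\<close> identity matrices this is Sylvester's identity
  \<open>det (1 - X Y) = det (1 - Y X)\<close>. Both sides equal \<open>det T'\<close> times the determinant
  of the block matrix with rows \<open>T, X\<close> and \<open>Y, 1\<close>. Clearing \<open>Y\<close> by column
  operations leaves \<open>T - X Y\<close> and 1 on the diagonal. The condition \<open>T X = X T'\<close> allows
  \<open>X\<close> to be cleared after its columns have been multiplied by \<open>T'\<close>, which leaves
  \<open>T\<close> and \<open>T' - Y X\<close>. No inverse of \<open>T\<close> is formed, so the identity applies to matrices of
  polynomials.\<close>

lemma det_intertwined_low_rank_update:
  fixes T T' X Y :: "'a :: idom mat"
  assumes T: "T \<in> carrier_mat n n" and T': "T' \<in> carrier_mat k k"
    and X: "X \<in> carrier_mat n k" and Y: "Y \<in> carrier_mat k n"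
    and TX: "T * X = X * T'"
  shows "det (T - X * Y) * det T' = det T * det (T' - Y * X)"
proof -
  let ?B = "four_block_mat T X Y (1\<^sub>m k)"
  have B: "?B \<in> carrier_mat (n + k) (n + k)"
    using T by (rule four_block_carrier_mat) simp
  have XY: "X * Y \<in> carrier_mat n n" and YX: "Y * X \<in> carrier_mat k k"
    and XT': "X * T' \<in> carrier_mat n k"
    using X Y T' by auto
  let ?L = "four_block_mat (1\<^sub>m n) (0\<^sub>m n k) (- Y) (1\<^sub>m k)"
  have "?B * ?L = four_block_mat (T - X * Y) X (0\<^sub>m k n) (1\<^sub>m k)"
    using T X Y XY
    by (subst mult_four_block_mat[of _ n n _ k _ k _ _ n _ k])
      (auto intro!: arg_cong4[where f = four_block_mat] eq_matI)
  then have "det (?B * ?L) = det (T - X * Y)"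
    using det_four_block_mat_lower_left_zero[OF minus_carrier_mat[OF XY] X refl one_carrier_mat] by simp
  moreover have "det ?L = 1"
    using Y by (subst det_four_block_mat_upper_right_zero[of _ n _ k]) auto
  moreover have "det (?B * ?L) = det ?B * det ?L"
    using B by (rule det_mult) (rule four_block_carrier_mat; simp)
  ultimately have left: "det ?B = det (T - X * Y)"
    by simp
  let ?R = "four_block_mat (1\<^sub>m n) (- X) (0\<^sub>m k n) T'"
  have "?B * ?R = four_block_mat T (0\<^sub>m n k) Y (T' - Y * X)"
    using T X Y T' YX XT' TX
    by (subst mult_four_block_mat[of _ n n _ k _ k _ _ n _ k])
      (auto intro!: arg_cong4[where f = four_block_mat] eq_matI)
  then have "det (?B * ?R) = det T * det (T' - Y * X)"
    using det_four_block_mat_upper_right_zero[OF T refl Y minus_carrier_mat[OF YX]] by simp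
  moreover have "det ?R = det T'"
    using X T' by (subst det_four_block_mat_lower_left_zero[of _ n _ k]) auto
  moreover have "det (?B * ?R) = det ?B * det ?R"
    using B by (rule det_mult) (rule four_block_carrier_mat; simp add: T')
  ultimately show ?thesis
    using left by simp
qed

text \<open>The entry \<open>s a a\<close> is the one shared by distinct indices of the class \<open>a\<close>; the
  function \<open>t\<close> is the amount by which the diagonal entries deviate from it.\<close>

definition class_mat :: "nat \<Rightarrow> (nat \<Rightarrow> nat) \<Rightarrow> (nat \<Rightarrow> nat \<Rightarrow> 'a) \<Rightarrow> (nat \<Rightarrow> 'a) \<Rightarrow> 'a :: comm_ring_1 mat"
  where "class_mat n c s t = mat n n (\<lambda>(i, j). s (c i) (c j) + (if i = j then t (c i) else 0))"

definition class_quotient_mat ::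
    "nat \<Rightarrow> (nat \<Rightarrow> nat) \<Rightarrow> nat \<Rightarrow> (nat \<Rightarrow> nat \<Rightarrow> 'a) \<Rightarrow> (nat \<Rightarrow> 'a) \<Rightarrow> 'a :: comm_ring_1 mat"
  where "class_quotient_mat n c k s t =
    mat k k (\<lambda>(a, b). s a b * of_nat (card {i. i < n \<and> c i = b}) + (if a = b then t a else 0))"

lemma det_mat_diag: "det (mat_diag n f) = (\<Prod>i<n. f i)"
proof -
  have "det (mat_diag n f) = prod_list (diag_mat (mat_diag n f))"
    by (rule det_upper_triangular[of _ n]) (auto simp: mat_diag_def upper_triangular_def)
  then show ?thesis
    by (simp add: prod_list_diag_prod mat_diag_def atLeast0LessThan)
qed

text \<open>The determinant identity is applied to \<open>T = x - diag(t)\<close> over all indices,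
  \<open>T' = x - diag(t)\<close> over the classes, \<open>X\<close> the incidence matrix of the classes, and
  \<open>Y = S X\<^sup>T\<close>. The intertwining condition \<open>T X = X T'\<close> says that the diagonal is
  constant on classes, and \<open>Y X\<close> multiplies each column of \<open>S\<close> by a class size.\<close>

lemma char_poly_class_mat_times:
  fixes s :: "nat \<Rightarrow> nat \<Rightarrow> 'a :: idom"
  assumes c: "\<And>i. i < n \<Longrightarrow> c i < k"
  shows "char_poly (class_mat n c s t) * (\<Prod>a<k. [:- t a, 1:]) =
    (\<Prod>i<n. [:- t (c i), 1:]) * char_poly (class_quotient_mat n c k s t)"
proof -
  define T where "T = mat_diag n (\<lambda>i. [:- t (c i), 1:])"
  define T' where "T' = mat_diag k (\<lambda>a. [:- t a, 1:])"
  define X where "X = mat n k (\<lambda>(i, a). if c i = a then 1 else 0 :: 'a poly)"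
  define Y where "Y = mat k n (\<lambda>(a, j). [: s a (c j) :])"
  have carrier: "T \<in> carrier_mat n n" "T' \<in> carrier_mat k k"
      "X \<in> carrier_mat n k" "Y \<in> carrier_mat k n"
    by (simp_all add: T_def T'_def X_def Y_def mat_diag_def)
  have "T * X = mat n k (\<lambda>(i, a). if c i = a then [:- t (c i), 1:] else 0)"
    using carrier(3) by (auto simp: T_def mat_diag_mult_left[of _ _ k] X_def)
  moreover have "X * T' = mat n k (\<lambda>(i, a). if c i = a then [:- t (c i), 1:] else 0)"
    using carrier(3) by (auto simp: T'_def mat_diag_mult_right[of _ n] X_def)
  ultimately have comm: "T * X = X * T'"
    by simp
  have XY: "X * Y = mat n n (\<lambda>(i, j). [: s (c i) (c j) :])"
  proof (rule eq_matI)
    fix i j assume "i < dim_row (mat n n (\<lambda>(i, j). [: s (c i) (c j) :]))"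
      "j < dim_col (mat n n (\<lambda>(i, j). [: s (c i) (c j) :]))"
    then have ij: "i < n" "j < n" by auto
    then have "(X * Y) $$ (i, j) = (\<Sum>a<k. (if c i = a then 1 else 0) * [: s a (c j) :])"
      by (simp add: X_def Y_def scalar_prod_def atLeast0LessThan)
    also have "\<dots> = (\<Sum>a<k. if c i = a then [: s a (c j) :] else 0)"
      by (intro sum.cong) auto
    also have "\<dots> = [: s (c i) (c j) :]"
      using c[OF ij(1)] by simp
    finally show "(X * Y) $$ (i, j) = mat n n (\<lambda>(i, j). [: s (c i) (c j) :]) $$ (i, j)"
      using ij by simp
  qed (simp_all add: X_def Y_def)
  let ?q = "\<lambda>(a, b). [: s a b * of_nat (card {i. i < n \<and> c i = b}) :]"
  have YX: "Y * X = mat k k ?q"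
  proof (rule eq_matI)
    fix a b assume "a < dim_row (mat k k ?q)" "b < dim_col (mat k k ?q)"
    then have ab: "a < k" "b < k" by auto
    then have "(Y * X) $$ (a, b) = (\<Sum>i<n. [: s a (c i) :] * (if c i = b then 1 else 0))"
      by (simp add: X_def Y_def scalar_prod_def atLeast0LessThan)
    also have "\<dots> = (\<Sum>i<n. if c i = b then [: s a b :] else 0)"
      by (intro sum.cong) auto
    also have "\<dots> = of_nat (card {i. i < n \<and> c i = b}) * [: s a b :]"
      by (simp add: sum.If_cases Collect_conj_eq lessThan_def)
    also have "\<dots> = [: s a b * of_nat (card {i. i < n \<and> c i = b}) :]"
      by (simp add: of_nat_poly mult.commute)
    finally show "(Y * X) $$ (a, b) = mat k k ?q $$ (a, b)"
      using ab by simp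
  qed (simp_all add: X_def Y_def)
  have "T - X * Y = char_poly_matrix (class_mat n c s t)"
    unfolding XY by (rule eq_matI) (auto simp: T_def mat_diag_def char_poly_matrix_def class_mat_def)
  moreover have "T' - Y * X = char_poly_matrix (class_quotient_mat n c k s t)"
    unfolding YX
    by (rule eq_matI) (auto simp: T'_def mat_diag_def char_poly_matrix_def class_quotient_mat_def)
  moreover have "det T' = (\<Prod>a<k. [:- t a, 1:])" "det T = (\<Prod>i<n. [:- t (c i), 1:])"
    by (simp_all add: T_def T'_def det_mat_diag)
  ultimately show ?thesis
    using det_intertwined_low_rank_update[OF carrier comm] by (simp add: char_poly_def)
qed

lemma prod_over_classes:
  fixes c :: "nat \<Rightarrow> nat" and f :: "nat \<Rightarrow> 'a :: comm_monoid_mult"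
  assumes "\<And>i. i < n \<Longrightarrow> c i < k"
  shows "(\<Prod>i<n. f (c i)) = (\<Prod>a<k. f a ^ card {i. i < n \<and> c i = a})"
proof -
  have "(\<Prod>i<n. f (c i)) = (\<Prod>a<k. \<Prod>i\<in>{i\<in>{..<n}. c i = a}. f (c i))"
    using assms by (intro prod.group[symmetric]) auto
  then show ?thesis by simp
qed

text \<open>If no class is empty, every factor \<open>x - t a\<close> on the left of
  \<open>char_poly_class_mat_times\<close> also occurs on the right, and all of them can be cancelled at
  once.\<close>

lemma char_poly_class_mat:
  fixes s :: "nat \<Rightarrow> nat \<Rightarrow> 'a :: idom"
  assumes "c ` {..<n} = {..<k}"
  shows "char_poly (class_mat n c s t) =
    (\<Prod>a<k. [:- t a, 1:] ^ (card {i. i < n \<and> c i = a} - 1)) *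
    char_poly (class_quotient_mat n c k s t)"
proof -
  let ?m = "\<lambda>a. card {i. i < n \<and> c i = a}"
  let ?P = "\<Prod>a<k. [:- t a, 1:]"
  have c: "c i < k" if "i < n" for i
    using assms that by auto
  have "?m a = Suc (?m a - 1)" if "a < k" for a
  proof -
    have "a \<in> c ` {..<n}" using that assms by simp
    then have "?m a > 0" by (auto simp: card_gt_0_iff)
    then show ?thesis by simp
  qed
  then have "(\<Prod>i<n. [:- t (c i), 1:]) = (\<Prod>a<k. [:- t a, 1:] ^ (?m a - 1) * [:- t a, 1:])"
    by (subst prod_over_classes[of n c k "\<lambda>a. [:- t a, 1:]", OF c])
      (auto intro!: prod.cong simp: power_Suc2[symmetric]
        simp del: power_Suc mult_pCons_left mult_pCons_right)
  then have "char_poly (class_mat n c s t) * ?P =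
      ((\<Prod>a<k. [:- t a, 1:] ^ (?m a - 1)) * char_poly (class_quotient_mat n c k s t)) * ?P"
    using char_poly_class_mat_times[of n c k s t, OF c]
    by (simp add: prod.distrib mult_ac del: mult_pCons_left mult_pCons_right)
  moreover have "?P \<noteq> 0"
    by simp
  ultimately show ?thesis
    by (rule mult_right_cancel[THEN iffD1, rotated])
qed

lemma eigenvalue_mset_class_mat:
  assumes "c ` {..<n} = {..<k}"
  shows "eigenvalue_mset (class_mat n c s t) =
    (\<Sum>a<k. replicate_mset (card {i. i < n \<and> c i = a} - 1) (complex_of_real (t a))) +
    eigenvalue_mset (class_quotient_mat n c k s t)"
proof -
  let ?s = "\<lambda>a b. complex_of_real (s a b)" and ?t = "\<lambda>a. complex_of_real (t a)"
  have A: "map_mat complex_of_real (class_mat n c s t) = class_mat n c ?s ?t"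
    by (rule eq_matI) (auto simp: class_mat_def)
  have Q: "map_mat complex_of_real (class_quotient_mat n c k s t) = class_quotient_mat n c k ?s ?t"
    by (rule eq_matI) (auto simp: class_quotient_mat_def)
  have "char_poly (class_quotient_mat n c k ?s ?t) \<noteq> 0"
    using degree_monic_char_poly[of "class_quotient_mat n c k ?s ?t" k]
    by (auto simp: class_quotient_mat_def)
  then show ?thesis
    unfolding eigenvalue_mset_def A Q char_poly_class_mat[OF assms]
    by (simp add: proots_mult proots_prod proots_power)
qed

section \<open>Distances in the torch graph\<close>

text \<open>Since \<open>d\<close> drops by at most 1 per arc, a walk from \<open>u\<close> to \<open>v\<close> has at
  least \<open>d u\<close> arcs; following arcs along which \<open>d\<close> drops gives a walk that has no more
  than that.\<close>

lemma (in wf_digraph) graph_dist_eqI: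
  fixes d :: "'a \<Rightarrow> nat"
  assumes target: "d v = 0"
    and lipschitz: "\<And>e. e \<in> arcs G \<Longrightarrow> d (tail G e) \<le> Suc (d (head G e))"
    and descent: "\<And>w. w \<in> verts G \<Longrightarrow> w \<noteq> v \<Longrightarrow>
      \<exists>e\<in>arcs G. tail G e = w \<and> Suc (d (head G e)) \<le> d w"
    and u: "u \<in> verts G" and v: "v \<in> verts G"
  shows "graph_dist G u v = real (d u)"
proof -
  have cost: "awalk_cost (\<lambda>_. 1) p = real (length p)" for p
    by (induction p) auto
  have lower: "d u \<le> length p" if "awalk u p v" for u p
    using that
  proof (induction p arbitrary: u)
    case Nil
    then show ?case using target by (simp add: awalk_Nil_iff)
  next
    case (Cons e p)
    then have "e \<in> arcs G" "tail G e = u" "d (head G e) \<le> length p"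
      by (auto simp: awalk_Cons_iff)
    then show ?case using lipschitz[of e] by simp
  qed
  have "\<exists>p. awalk u p v \<and> length p \<le> d u"
    using u
  proof (induction "d u" arbitrary: u rule: less_induct)
    case less
    show ?case
    proof (cases "u = v")
      case True
      then show ?thesis using v by (intro exI[of _ "[]"]) (simp add: awalk_Nil_iff)
    next
      case False
      then obtain e where e: "e \<in> arcs G" "tail G e = u" "Suc (d (head G e)) \<le> d u"
        using descent less.prems by blast
      then obtain p where "awalk (head G e) p v" "length p \<le> d (head G e)"
        using less.hyps[of "head G e"] by auto
      then show ?thesis
        using e by (intro exI[of _ "e # p"]) (auto simp: awalk_Cons_iff)
    qed
  qed
  then obtain p where p: "awalk u p v" "length p \<le> d u"
    by blast
  have "\<mu> (\<lambda>_. 1) u v = ereal (d u)"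
  proof (rule antisym)
    show "\<mu> (\<lambda>_. 1) u v \<le> ereal (d u)"
      using min_cost_le_walk_cost[OF p(1), of "\<lambda>_. 1"] p(2)
      by (elim order_trans) (simp add: cost)
    show "ereal (d u) \<le> \<mu> (\<lambda>_. 1) u v"
      unfolding \<mu>_def using lower by (intro INF_greatest) (simp add: cost)
  qed
  then show ?thesis
    by (simp add: graph_dist_def)
qed

text \<open>The numbers of the classes follow the order of the rows of \<open>torch_mat\<close>.\<close>

definition torch_class :: "nat \<Rightarrow> nat \<Rightarrow> nat" where
  "torch_class n v =
    (if v = 1 then 0
     else if v = n - 1 then 2
     else if v = n then 3
     else if v = n + 1 \<or> v = n + 3 then 4
     else if v = n + 2 \<or> v = n + 4 then 5
     else 1)"

text \<open>The distance between distinct vertices of the classes \<open>a\<close> and \<open>b\<close>. The classes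
  0, 2 and 3 have a single element; their diagonal entry 0 is a default, chosen so that 1 stands for
  adjacency and every entry that is realised by two distinct vertices is positive.\<close>

definition torch_class_dist :: "nat \<Rightarrow> nat \<Rightarrow> nat" where
  "torch_class_dist a b =
    [[0, 2, 2, 1, 1, 1],
     [2, 2, 4, 3, 1, 3],
     [2, 4, 0, 1, 3, 2],
     [1, 3, 1, 0, 2, 1],
     [1, 1, 3, 2, 1, 2],
     [1, 3, 2, 1, 2, 2]] ! a ! b"

text \<open>This form of the bound turns facts about all classes into bounded quantifications over a list,
  which can be evaluated.\<close>

lemma less_6_iff: "a < (6 :: nat) \<longleftrightarrow> a \<in> set [0..<6]"
  by auto

lemma torch_class_dist_step:
  assumes "a < 6" "b < 6" "c < 6" "torch_class_dist a b = 1"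
  shows "torch_class_dist a c \<le> Suc (torch_class_dist b c)"
proof -
  have "\<forall>a\<in>set [0..<6]. \<forall>b\<in>set [0..<6]. \<forall>c\<in>set [0..<6].
      torch_class_dist a b = 1 \<longrightarrow> torch_class_dist a c \<le> Suc (torch_class_dist b c)"
    by code_simp
  then show ?thesis using assms unfolding less_6_iff by blast
qed

text \<open>The next vertex on a shortest path can be taken in a class \<open>b\<close> other than
  \<open>a\<close>. Any representative of \<open>b\<close> then differs from the present vertex, which makes it
  a neighbour.\<close>

lemma torch_class_dist_descent:
  assumes "a < 6" "c < 6" "torch_class_dist a c \<ge> 2"
  shows "\<exists>b<6. b \<noteq> a \<and> torch_class_dist a b = 1 \<and>
    Suc (torch_class_dist b c) \<le> torch_class_dist a c"
proof -
  have "\<forall>a\<in>set [0..<6]. \<forall>c\<in>set [0..<6]. torch_class_dist a c \<ge> 2 \<longrightarrow>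
      (\<exists>b\<in>set [0..<6]. b \<noteq> a \<and> torch_class_dist a b = 1 \<and>
        Suc (torch_class_dist b c) \<le> torch_class_dist a c)"
    by code_simp
  then show ?thesis using assms unfolding less_6_iff by blast
qed

lemma torch_class_dist_eq_0D:
  assumes "a < 6" "b < 6" "torch_class_dist a b = 0"
  shows "a = b \<and> a \<in> {0, 2, 3}"
proof -
  have "\<forall>a\<in>set [0..<6]. \<forall>b\<in>set [0..<6]. torch_class_dist a b = 0 \<longrightarrow> a = b \<and> a \<in> {0, 2, 3}"
    by code_simp
  then show ?thesis using assms unfolding less_6_iff by blast
qed

lemma torch_class_less: "torch_class n v < 6"
  by (simp add: torch_class_def)

lemma torch_vertex_cases:
  fixes n v :: nat
  assumes "v \<in> {1..n + 4}"
  shows "v = 1 \<or> v \<in> {2..n - 2} \<or> v = n - 1 \<or> v = n \<or>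
    v = n + 1 \<or> v = n + 2 \<or> v = n + 3 \<or> v = n + 4"
  using assms by auto

lemma torch_class_values:
  assumes "n \<ge> 4"
  shows "torch_class n 1 = 0" "v \<in> {2..n - 2} \<Longrightarrow> torch_class n v = 1"
    "torch_class n (n - 1) = 2" "torch_class n n = 3"
    "torch_class n (n + 1) = 4" "torch_class n (n + 2) = 5"
    "torch_class n (n + 3) = 4" "torch_class n (n + 4) = 5"
  using assms by (auto simp: torch_class_def)

lemma torch_class_eq_iff:
  assumes "n \<ge> 4" "v \<in> {1..n + 4}"
  shows "torch_class n v = 0 \<longleftrightarrow> v = 1"
    and "torch_class n v = 1 \<longleftrightarrow> v \<in> {2..n - 2}"
    and "torch_class n v = 2 \<longleftrightarrow> v = n - 1"
    and "torch_class n v = 3 \<longleftrightarrow> v = n"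
    and "torch_class n v = 4 \<longleftrightarrow> v \<in> {n + 1, n + 3}"
    and "torch_class n v = 5 \<longleftrightarrow> v \<in> {n + 2, n + 4}"
  using torch_vertex_cases[OF assms(2)] \<open>n \<ge> 4\<close>
  by (elim disjE; simp only: torch_class_values; force)+

lemma nat_less_6_cases: "a < (6 :: nat) \<Longrightarrow> a = 0 \<or> a = 1 \<or> a = 2 \<or> a = 3 \<or> a = 4 \<or> a = 5"
  by auto

lemma torch_class_representative:
  assumes "n \<ge> 4" "a < 6"
  obtains v where "v \<in> {1..n + 4}" "torch_class n v = a"
proof -
  have "torch_class n ([1, 2, n - 1, n, n + 1, n + 2] ! a) = a"
      "[1, 2, n - 1, n, n + 1, n + 2] ! a \<in> {1..n + 4}"
    using nat_less_6_cases[OF \<open>a < 6\<close>] \<open>n \<ge> 4\<close> by (auto simp: torch_class_def)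
  then show thesis using that by blast
qed

lemma torch_class_dist_eq_1_iff:
  assumes "a < 6" "b < 6"
  shows "torch_class_dist a b = 1 \<longleftrightarrow> (a, b) = (4, 4) \<or>
    (a, b) \<in> {(4, 1), (0, 4), (0, 5), (3, 0), (3, 5), (3, 2)} \<or>
    (b, a) \<in> {(4, 1), (0, 4), (0, 5), (3, 0), (3, 5), (3, 2)}"
proof -
  have *: "\<forall>a\<in>set [0..<6]. \<forall>b\<in>set [0..<6]. torch_class_dist a b = 1 \<longleftrightarrow> (a, b) = (4, 4) \<or>
      (a, b) \<in> {(4, 1), (0, 4), (0, 5), (3, 0), (3, 5), (3, 2)} \<or>
      (b, a) \<in> {(4, 1), (0, 4), (0, 5), (3, 0), (3, 5), (3, 2)}"
    by code_simp
  show ?thesis using assms unfolding less_6_iff by (rule *[rule_format])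
qed

text \<open>All edges except \<open>v\<^bsub>n+1\<^esub>v\<^bsub>n+3\<^esub>\<close> join different classes, and two
  classes are joined either completely or not at all.\<close>

lemma torch_edges_iff:
  assumes "n \<ge> 4" "u \<in> {1..n + 4}" "v \<in> {1..n + 4}"
  shows "(u, v) \<in> torch_edges n \<longleftrightarrow> u = n + 1 \<and> v = n + 3 \<or>
    (torch_class n u, torch_class n v) \<in> {(4, 1), (0, 4), (0, 5), (3, 0), (3, 5), (3, 2)}"
proof -
  have "(u, v) \<in> torch_edges n \<longleftrightarrow> u = n + 1 \<and> v = n + 3 \<or>
      u \<in> {n + 1, n + 3} \<and> v \<in> {2..n - 2} \<or> u = 1 \<and> v \<in> {n + 1, n + 3} \<or>
      u = 1 \<and> v \<in> {n + 2, n + 4} \<or> u = n \<and> v = 1 \<or> u = n \<and> v \<in> {n + 2, n + 4} \<or>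
      u = n \<and> v = n - 1"
    unfolding torch_edges_def by auto
  then show ?thesis
    by (simp only: torch_class_eq_iff[OF assms(1,2)] torch_class_eq_iff[OF assms(1,3)]
        insert_iff[of "(_, _)"] empty_iff prod.inject simp_thms)
qed

lemma torch_arcs_iff:
  assumes "n \<ge> 4" "u \<in> {1..n + 4}" "v \<in> {1..n + 4}"
  shows "(u, v) \<in> parcs (torch_graph n) \<longleftrightarrow>
    u \<noteq> v \<and> torch_class_dist (torch_class n u) (torch_class n v) = 1"
proof -
  define E :: "(nat \<times> nat) set" where "E = {(4, 1), (0, 4), (0, 5), (3, 0), (3, 5), (3, 2)}"
  let ?c = "torch_class n"
  have "(u, v) \<in> parcs (torch_graph n) \<longleftrightarrow> (u, v) \<in> torch_edges n \<or> (v, u) \<in> torch_edges n"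
    by (simp add: torch_graph_def)
  also have "\<dots> \<longleftrightarrow> (u = n + 1 \<and> v = n + 3 \<or> v = n + 1 \<and> u = n + 3) \<or>
      (?c u, ?c v) \<in> E \<or> (?c v, ?c u) \<in> E"
    unfolding torch_edges_iff[OF assms] torch_edges_iff[OF assms(1,3,2)] E_def[symmetric] by blast
  also have "u = n + 1 \<and> v = n + 3 \<or> v = n + 1 \<and> u = n + 3 \<longleftrightarrow> u \<noteq> v \<and> (?c u, ?c v) = (4, 4)"
    unfolding prod.inject torch_class_eq_iff[OF assms(1,2)] torch_class_eq_iff[OF assms(1,3)]
    by auto
  also have "u \<noteq> v \<and> (?c u, ?c v) = (4, 4) \<or> (?c u, ?c v) \<in> E \<or> (?c v, ?c u) \<in> E \<longleftrightarrow>
      u \<noteq> v \<and> ((?c u, ?c v) = (4, 4) \<or> (?c u, ?c v) \<in> E \<or> (?c v, ?c u) \<in> E)"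
  proof -
    \<comment> \<open>A pair of \<open>E\<close> consists of different classes, so it forces \<open>u \<noteq> v\<close>.\<close>
    have "(x, x) \<notin> E" for x
      by (auto simp: E_def)
    then show ?thesis by metis
  qed
  also have "\<dots> \<longleftrightarrow> u \<noteq> v \<and> torch_class_dist (?c u) (?c v) = 1"
    unfolding torch_class_dist_eq_1_iff[OF torch_class_less torch_class_less] E_def ..
  finally show ?thesis .
qed

lemma graph_dist_torch_graph:
  assumes n: "n \<ge> 4" and u: "u \<in> {1..n + 4}" and v: "v \<in> {1..n + 4}"
  shows "graph_dist (with_proj (torch_graph n)) u v =
    (if u = v then 0 else real (torch_class_dist (torch_class n u) (torch_class n v)))"
proof -
  interpret pair_graph "torch_graph n"
    by (rule pair_graph_torch_graph[OF n])
  let ?c = "torch_class n" and ?D = torch_class_dist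
  define d where "d w = (if w = v then 0 else ?D (?c w) (?c v))" for w
  have "graph_dist (with_proj (torch_graph n)) u v = real (d u)"
  proof (rule wf_digraph.graph_dist_eqI[OF wf_digraph_axioms])
    show "d v = 0"
      by (simp add: d_def)
  next
    fix e assume e: "e \<in> arcs (with_proj (torch_graph n))"
    obtain x y where xy: "e = (x, y)" by (cases e)
    have "x \<in> {1..n + 4}" "y \<in> {1..n + 4}"
      using e wellformed[of e] unfolding xy by (simp_all add: torch_graph_def)
    then have "?D (?c x) (?c y) = 1"
      using e torch_arcs_iff[OF n, of x y] by (simp add: xy)
    then have "d x \<le> Suc (d y)"
      using torch_class_dist_step[of "?c x" "?c y" "?c v"] by (auto simp: d_def torch_class_less)
    then show "d (tail (with_proj (torch_graph n)) e) \<le> Suc (d (head (with_proj (torch_graph n)) e))"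
      by (simp add: xy)
  next
    fix w assume "w \<in> verts (with_proj (torch_graph n))" and "w \<noteq> v"
    then have w: "w \<in> {1..n + 4}" by (simp add: torch_graph_def)
    \<comment> \<open>The entry 0 occurs only on the diagonal, at classes with one element.\<close>
    have pos: "?D (?c w) (?c v) \<noteq> 0"
    proof
      assume "?D (?c w) (?c v) = 0"
      then have "?c w = ?c v" "?c w \<in> {0, 2, 3}"
        using torch_class_dist_eq_0D torch_class_less by blast+
      then show False
        using \<open>w \<noteq> v\<close> torch_class_eq_iff[OF n w] torch_class_eq_iff[OF n v] by auto
    qed
    \<comment> \<open>At distance 1 the step leads to \<open>v\<close> itself, where \<open>d\<close> is 0 although the
      diagonal entry of its class may be positive.\<close>
    obtain x where "x \<in> {1..n + 4}" "(w, x) \<in> parcs (torch_graph n)" "Suc (d x) \<le> d w"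
    proof (cases "?D (?c w) (?c v) = 1")
      case True
      show ?thesis
        using True \<open>w \<noteq> v\<close> torch_arcs_iff[OF n w v] v by (intro that[of v]) (auto simp: d_def)
    next
      case False
      then have "?D (?c w) (?c v) \<ge> 2" using pos by simp
      then obtain b where b: "b < 6" "b \<noteq> ?c w" "?D (?c w) b = 1" "Suc (?D b (?c v)) \<le> ?D (?c w) (?c v)"
        using torch_class_dist_descent[OF torch_class_less torch_class_less] by blast
      obtain x where x: "x \<in> {1..n + 4}" "?c x = b"
        using torch_class_representative[OF n b(1)] .
      show ?thesis
        using b x \<open>w \<noteq> v\<close> torch_arcs_iff[OF n w x(1)]
        by (intro that[of x]) (auto simp: d_def)
    qed
    then show "\<exists>e\<in>arcs (with_proj (torch_graph n)). tail (with_proj (torch_graph n)) e = w \<and>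
        Suc (d (head (with_proj (torch_graph n)) e)) \<le> d w"
      by (intro bexI[of _ "(w, x)"]) auto
  qed (use u v in \<open>simp_all add: torch_graph_def\<close>)
  then show ?thesis
    by (simp add: d_def)
qed

section \<open>The generalised distance matrix of the torch graph\<close>

definition torch_class_size :: "nat \<Rightarrow> nat \<Rightarrow> nat" where
  "torch_class_size n a = [1, n - 3, 1, 1, 2, 2] ! a"

lemma card_torch_class:
  assumes "n \<ge> 4" "a < 6"
  shows "card {v \<in> {1..n + 4}. torch_class n v = a} = torch_class_size n a"
proof -
  let ?V = "[{1}, {2..n - 2}, {n - 1}, {n}, {n + 1, n + 3}, {n + 2, n + 4}] ! a"
  have "torch_class n v = a \<longleftrightarrow> v \<in> ?V" if "v \<in> {1..n + 4}" for v
    using nat_less_6_cases[OF \<open>a < 6\<close>]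
    by (elim disjE) (simp_all add: torch_class_eq_iff[OF \<open>n \<ge> 4\<close> that, simplified])
  moreover have "?V \<subseteq> {1..n + 4}"
    using nat_less_6_cases[OF \<open>a < 6\<close>] \<open>n \<ge> 4\<close> by (elim disjE) auto
  ultimately have "{v \<in> {1..n + 4}. torch_class n v = a} = ?V"
    by blast
  also have "card ?V = torch_class_size n a"
    using nat_less_6_cases[OF \<open>a < 6\<close>] \<open>n \<ge> 4\<close> by (auto simp: torch_class_size_def)
  finally show ?thesis .
qed

lemma sum_over_torch_classes:
  fixes f :: "nat \<Rightarrow> real"
  assumes "n \<ge> 4"
  shows "(\<Sum>v\<in>{1..n + 4}. f (torch_class n v)) = (\<Sum>a<6. real (torch_class_size n a) * f a)"
proof -
  have "(\<Sum>v\<in>{1..n + 4}. f (torch_class n v)) =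
      (\<Sum>a<6. \<Sum>v\<in>{v\<in>{1..n + 4}. torch_class n v = a}. f (torch_class n v))"
    by (intro sum.group[symmetric]) (auto simp: torch_class_less)
  then show ?thesis
    using card_torch_class[OF assms] by simp
qed

definition torch_class_transmission :: "nat \<Rightarrow> nat \<Rightarrow> real" where
  "torch_class_transmission n a =
    [2 * real n + 1, 2 * real n + 9, 4 * real n + 1, 3 * real n - 1, real n + 8, 3 * real n + 1] ! a"

lemma sum_less_6: "(\<Sum>a<6. g a) = g 0 + g 1 + g 2 + g 3 + g 4 + g (5 :: nat)"
  for g :: "nat \<Rightarrow> 'a :: comm_monoid_add"
  by (simp add: eval_nat_numeral)

text \<open>The sum over the classes counts \<open>u\<close> itself with the diagonal entry of its class, which
  has to be subtracted again.\<close>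

lemma transmission_torch_graph:
  assumes n: "n \<ge> 4" and u: "u \<in> {1..n + 4}"
  shows "transmission (with_proj (torch_graph n)) u = torch_class_transmission n (torch_class n u)"
proof -
  let ?D = "\<lambda>a b. real (torch_class_dist a b)" and ?c = "torch_class n"
  have verts: "verts (with_proj (torch_graph n)) = {1..n + 4}"
    by (simp add: torch_graph_def)
  have "transmission (with_proj (torch_graph n)) u =
      (\<Sum>w\<in>{1..n + 4}. ?D (?c w) (?c u) - (if w = u then ?D (?c w) (?c u) else 0))"
    unfolding transmission_def verts using n u
    by (intro sum.cong) (auto simp: graph_dist_torch_graph)
  also have "\<dots> = (\<Sum>w\<in>{1..n + 4}. ?D (?c w) (?c u)) - ?D (?c u) (?c u)"
    using u by (simp add: sum_subtractf)
  also have "\<dots> = (\<Sum>a<6. real (torch_class_size n a) * ?D a (?c u)) - ?D (?c u) (?c u)"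
    unfolding sum_over_torch_classes[OF n, of "\<lambda>a. ?D a (?c u)"] ..
  also have "\<dots> = torch_class_transmission n (?c u)"
    using nat_less_6_cases[OF torch_class_less[of n u]] n
    by (elim disjE)
      (simp_all add: sum_less_6 torch_class_size_def torch_class_dist_def torch_class_transmission_def
        of_nat_diff)
  finally show ?thesis .
qed

definition torch_offdiag :: "real \<Rightarrow> nat \<Rightarrow> nat \<Rightarrow> real" where
  "torch_offdiag \<alpha> a b = (1 - \<alpha>) * real (torch_class_dist a b)"

text \<open>For twins \<open>u\<close> and \<open>v\<close> of class \<open>a\<close>, this is the eigenvalue of
  \<open>e\<^sub>u - e\<^sub>v\<close>: the diagonal entry minus the entry shared by the two twins.\<close>

definition torch_twin_eigenvalue :: "real \<Rightarrow> nat \<Rightarrow> nat \<Rightarrow> real" where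
  "torch_twin_eigenvalue \<alpha> n a =
    \<alpha> * torch_class_transmission n a - (1 - \<alpha>) * real (torch_class_dist a a)"

lemma gen_distance_mat_torch_graph:
  assumes n: "n \<ge> 4"
  shows "gen_distance_mat \<alpha> (with_proj (torch_graph n)) [1..<n + 5] =
    class_mat (n + 4) (\<lambda>i. torch_class n (Suc i)) (torch_offdiag \<alpha>) (torch_twin_eigenvalue \<alpha> n)"
  by (rule eq_matI)
    (auto simp: gen_distance_mat_def class_mat_def transmission_mat_def distance_mat_def mat_diag_def
      graph_dist_torch_graph[OF n] transmission_torch_graph[OF n] torch_offdiag_def
      torch_twin_eigenvalue_def simp del: upt_Suc)

lemma card_torch_class_index:
  assumes "n \<ge> 4" "a < 6"
  shows "card {i. i < n + 4 \<and> torch_class n (Suc i) = a} = torch_class_size n a"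
proof -
  have "bij_betw Suc {i. i < n + 4 \<and> torch_class n (Suc i) = a} {v \<in> {1..n + 4}. torch_class n v = a}"
    by (rule bij_betw_byWitness[of _ "\<lambda>v. v - 1"]) auto
  then show ?thesis
    unfolding card_torch_class[OF assms, symmetric] by (rule bij_betw_same_card)
qed

text \<open>The entry 0 chosen for the classes with one element makes their twin eigenvalue equal to the
  diagonal entry of the generalised distance matrix, which is what \<open>torch_mat\<close> has there.\<close>

lemma class_quotient_mat_torch_graph:
  assumes n: "n \<ge> 4"
  shows "class_quotient_mat (n + 4) (\<lambda>i. torch_class n (Suc i)) 6
      (torch_offdiag \<alpha>) (torch_twin_eigenvalue \<alpha> n) =
    torch_mat (real n) \<alpha> (1 - \<alpha>) ((1 - \<alpha>) * (real n - 3))" (is "?Q = ?M")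
proof (rule eq_matI)
  have dim: "dim_row ?M = 6" "dim_col ?M = 6"
    by (simp_all add: torch_mat_def mat_of_rows_list_def)
  then show "dim_row ?Q = dim_row ?M" "dim_col ?Q = dim_col ?M"
    by (simp_all add: class_quotient_mat_def)
  fix a b assume "a < dim_row ?M" "b < dim_col ?M"
  then have ab: "a < 6" "b < 6" by (simp_all add: dim)
  have "?Q $$ (a, b) = (1 - \<alpha>) * real (torch_class_dist a b) * real (torch_class_size n b) +
      (if a = b then torch_twin_eigenvalue \<alpha> n a else 0)"
    using ab n by (simp add: class_quotient_mat_def card_torch_class_index torch_offdiag_def)
  also have "\<dots> = ?M $$ (a, b)"
    using nat_less_6_cases[OF ab(1)] nat_less_6_cases[OF ab(2)] n
    by (elim disjE)
      (simp_all add: torch_mat_def mat_of_rows_list_def torch_class_dist_def torch_class_size_def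
        torch_twin_eigenvalue_def torch_class_transmission_def of_nat_diff algebra_simps)
  finally show "?Q $$ (a, b) = ?M $$ (a, b)" .
qed

theorem theorem4p3:
  fixes n :: nat and \<alpha> \<beta> \<gamma> :: real
  assumes "n \<ge> 4" and "0 \<le> \<alpha>" and "\<alpha> \<le> 1"
    and "\<beta> = 1 - \<alpha>" and "\<gamma> = (1 - \<alpha>) * (real n - 3)"
  shows "torch_gen_distance_spec \<alpha> n =
    replicate_mset (n - 4) (complex_of_real ((2 * real n + 11) * \<alpha> - 2))
    + {# complex_of_real ((3 * real n + 3) * \<alpha> - 2),
         complex_of_real ((real n + 9) * \<alpha> - 1) #}
    + eigenvalue_mset (torch_mat (real n) \<alpha> \<beta> \<gamma>)"
proof -
  let ?c = "\<lambda>i. torch_class n (Suc i)" and ?t = "torch_twin_eigenvalue \<alpha> n"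
  have "a \<in> ?c ` {..<n + 4}" if a: "a < 6" for a
  proof -
    obtain v where "v \<in> {1..n + 4}" "torch_class n v = a"
      using torch_class_representative[OF \<open>n \<ge> 4\<close> a] .
    then show ?thesis by (intro image_eqI[of _ _ "v - 1"]) auto
  qed
  then have onto: "?c ` {..<n + 4} = {..<6}"
    by (auto simp: torch_class_less)
  have "torch_gen_distance_spec \<alpha> n =
      (\<Sum>a<6. replicate_mset (torch_class_size n a - 1) (complex_of_real (?t a))) +
      eigenvalue_mset (torch_mat (real n) \<alpha> \<beta> \<gamma>)"
    unfolding torch_gen_distance_spec_def gen_distance_mat_torch_graph[OF \<open>n \<ge> 4\<close>]
      eigenvalue_mset_class_mat[OF onto] class_quotient_mat_torch_graph[OF \<open>n \<ge> 4\<close>] assms(4,5)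
    using card_torch_class_index[OF \<open>n \<ge> 4\<close>] by simp
  also have "(\<Sum>a<6. replicate_mset (torch_class_size n a - 1) (complex_of_real (?t a))) =
      replicate_mset (n - 4) (complex_of_real (?t 1)) +
      {# complex_of_real (?t 5), complex_of_real (?t 4) #}"
    \<comment> \<open>The classes 0, 2 and 3 have one element and contribute nothing.\<close>
    by (simp add: sum_less_6 torch_class_size_def)
  also have "?t 1 = (2 * real n + 11) * \<alpha> - 2"
    by (simp add: torch_twin_eigenvalue_def torch_class_transmission_def torch_class_dist_def
        algebra_simps)
  also have "?t 5 = (3 * real n + 3) * \<alpha> - 2"
    by (simp add: torch_twin_eigenvalue_def torch_class_transmission_def torch_class_dist_def
        algebra_simps)
  also have "?t 4 = (real n + 9) * \<alpha> - 1"
    by (simp add: torch_twin_eigenvalue_def torch_class_transmission_def torch_class_dist_def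
        algebra_simps)
  finally show ?thesis .
qed

end
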